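(* For $d\ge 2$, $$\overline{\mathrm{NM}}_d\cap I(d)=\{Y^d[1:0]\}.$$
   Context: A point $f\in\mathbb{P}^{2d+1}$ is identified with a pair $[F_a(X,Y):F_b(X,Y)]$ of homogeneous degree $d$ polynomials over $\mathbb{C}$ (not both zero, up to common scaling). Write $f=H_f\hat f$ with $H_f=\gcd(F_a,F_b)$ and $\hat f=[F_a/H_f:F_b/H_f]$, a rational map of degree at most $d$; $\mathrm{Rat}_d$ is the set of $f$ with $\deg\hat f=d$. $I(d)$ is the set of $f=H_f\hat f\in\mathbb{P}^{2d+1}$ such that $\hat f\equiv h\in\mathbb{P}^1$ is constant and $H_f(h)=0$. $\mathrm{NM}_d\subset\mathrm{Rat}_d$ is the set of Newton maps $N_P(z)=z-P(z)/P'(z)$ where $P$ is a monic degree $d$ complex polynomial with $d$ distinct roots, and $\overline{\mathrm{NM}}_d$ is its closure in $\mathbb{P}^{2d+1}$. $Y^d[1:0]$ denotes the point $[Y^d:0]\in\mathbb{P}^{2d+1}$. *)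

theory Defs
  imports "HOL-Analysis.Analysis" "HOL-Computational_Algebra.Computational_Algebra"
    "HOL-Computational_Algebra.Field_as_Ring"
begin

text \<open>
  Complex projective space of dimension \<open>n\<close>. Homogeneous coordinates are functions
  \<^typ>\<open>nat \<Rightarrow> complex\<close> supported on \<open>{0..n}\<close>; on these the product topology of
  \<^typ>\<open>nat \<Rightarrow> complex\<close> restricts to the Euclidean topology of vectors of length \<open>n + 1\<close>.
\<close>

definition hcoords :: "nat \<Rightarrow> (nat \<Rightarrow> complex) set" where
  "hcoords n = {v. (\<forall>i>n. v i = 0) \<and> (\<exists>i. v i \<noteq> 0)}"

definition proj_rel :: "nat \<Rightarrow> ((nat \<Rightarrow> complex) \<times> (nat \<Rightarrow> complex)) set" where
  "proj_rel n = {(u, v). u \<in> hcoords n \<and> v \<in> hcoords n \<and> (\<exists>c. c \<noteq> 0 \<and> v = (\<lambda>i. c * u i))}"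

definition proj_space :: "nat \<Rightarrow> (nat \<Rightarrow> complex) set set" where
  "proj_space n = hcoords n // proj_rel n"

definition proj_pt :: "nat \<Rightarrow> (nat \<Rightarrow> complex) \<Rightarrow> (nat \<Rightarrow> complex) set" where
  "proj_pt n v = proj_rel n `` {v}"

text \<open>The quotient topology (see \<open>quotient_map_proj_pt\<close> below).\<close>

definition proj_topology :: "nat \<Rightarrow> (nat \<Rightarrow> complex) set topology" where
  "proj_topology n = topology (\<lambda>U. U \<subseteq> proj_space n \<and>
     openin (top_of_set (hcoords n)) {v \<in> hcoords n. proj_pt n v \<in> U})"

lemma equiv_proj_rel: "equiv (hcoords n) (proj_rel n)"
proof (rule equivI)
  show "proj_rel n \<subseteq> hcoords n \<times> hcoords n"
    by (auto simp: proj_rel_def)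
  show "refl_on (hcoords n) (proj_rel n)"
    by (auto simp: refl_on_def proj_rel_def intro!: exI[of _ 1])
  show "sym (proj_rel n)"
  proof (rule symI)
    fix u v assume "(u, v) \<in> proj_rel n"
    then obtain c where "u \<in> hcoords n" "v \<in> hcoords n" "c \<noteq> 0" "v = (\<lambda>i. c * u i)"
      by (auto simp: proj_rel_def)
    then show "(v, u) \<in> proj_rel n"
      by (auto simp: proj_rel_def intro!: exI[of _ "inverse c"])
  qed
  show "trans (proj_rel n)"
  proof (rule transI)
    fix u v w assume "(u, v) \<in> proj_rel n" "(v, w) \<in> proj_rel n"
    then obtain c e where "u \<in> hcoords n" "w \<in> hcoords n" "c \<noteq> 0" "e \<noteq> 0"
        "v = (\<lambda>i. c * u i)" "w = (\<lambda>i. e * v i)"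
      by (auto simp: proj_rel_def)
    then show "(u, w) \<in> proj_rel n"
      by (auto simp: proj_rel_def intro!: exI[of _ "e * c"])
  qed
qed

lemma openin_proj_topology:
  "openin (proj_topology n) U \<longleftrightarrow> U \<subseteq> proj_space n \<and>
     openin (top_of_set (hcoords n)) {v \<in> hcoords n. proj_pt n v \<in> U}"
proof -
  let ?P = "\<lambda>U. U \<subseteq> proj_space n \<and>
     openin (top_of_set (hcoords n)) {v \<in> hcoords n. proj_pt n v \<in> U}"
  have "istopology ?P"
    unfolding istopology_def
  proof (intro conjI allI impI)
    fix S T assume "?P S" "?P T"
    then have "openin (top_of_set (hcoords n))
        ({v \<in> hcoords n. proj_pt n v \<in> S} \<inter> {v \<in> hcoords n. proj_pt n v \<in> T})"
      by blast
    moreover have "{v \<in> hcoords n. proj_pt n v \<in> S} \<inter> {v \<in> hcoords n. proj_pt n v \<in> T}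
        = {v \<in> hcoords n. proj_pt n v \<in> S \<inter> T}"
      by blast
    ultimately show "openin (top_of_set (hcoords n)) {v \<in> hcoords n. proj_pt n v \<in> S \<inter> T}"
      by simp
    show "S \<inter> T \<subseteq> proj_space n"
      using \<open>?P S\<close> by blast
  next
    fix K assume K: "\<forall>S\<in>K. ?P S"
    then have "openin (top_of_set (hcoords n)) (\<Union>S\<in>K. {v \<in> hcoords n. proj_pt n v \<in> S})"
      by blast
    moreover have "(\<Union>S\<in>K. {v \<in> hcoords n. proj_pt n v \<in> S})
        = {v \<in> hcoords n. proj_pt n v \<in> \<Union>K}"
      by blast
    ultimately show "openin (top_of_set (hcoords n)) {v \<in> hcoords n. proj_pt n v \<in> \<Union>K}"
      by simp
    show "\<Union>K \<subseteq> proj_space n"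
      using K by blast
  qed
  then show ?thesis
    by (simp add: proj_topology_def topology_inverse')
qed

lemma topspace_proj_topology: "topspace (proj_topology n) = proj_space n"
proof
  show "topspace (proj_topology n) \<subseteq> proj_space n"
    using openin_topspace openin_proj_topology by blast
  have "{v \<in> hcoords n. proj_pt n v \<in> proj_space n} = hcoords n"
    by (auto simp: proj_space_def proj_pt_def quotientI)
  then have "openin (proj_topology n) (proj_space n)"
    by (simp add: openin_proj_topology)
  then show "proj_space n \<subseteq> topspace (proj_topology n)"
    by (rule openin_subset)
qed

lemma quotient_map_proj_pt:
  "quotient_map (top_of_set (hcoords n)) (proj_topology n) (proj_pt n)"
  unfolding quotient_map_def topspace_proj_topology openin_proj_topology
  by (auto simp: proj_space_def proj_pt_def quotient_def)

text \<open>
  Bivariate polynomials over \<open>\<complex>\<close> are elements of \<^typ>\<open>complex poly poly\<close>: \<open>varX\<close> is the variable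
  of the coefficient ring, \<open>varY\<close> the outer variable, so \<open>coeff (coeff F j) i\<close> is the
  coefficient of \<open>X^i Y^j\<close>.
\<close>

definition varX :: "complex poly poly" where "varX = [:[:0, 1:]:]"

definition varY :: "complex poly poly" where "varY = [:0, 1:]"

definition eval2 :: "complex poly poly \<Rightarrow> complex \<Rightarrow> complex \<Rightarrow> complex" where
  "eval2 F x y = poly (poly F [:y:]) x"

definition total_degree :: "complex poly poly \<Rightarrow> nat" where
  "total_degree F = Max (insert 0 {i + j |i j. coeff (coeff F j) i \<noteq> 0})"

definition hform :: "nat \<Rightarrow> (nat \<Rightarrow> complex) \<Rightarrow> complex poly poly" where
  "hform d a = (\<Sum>i\<le>d. smult [:a i:] (varX ^ i * varY ^ (d - i)))"

text \<open>
  The identification of the point with homogeneous coordinates \<open>v\<close> in dimension \<open>2 * d + 1\<close> with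
  the pair of forms \<open>[Fa d v : Fb d v]\<close>: the coordinates \<open>0..d\<close> are the coefficients of the
  first form, the coordinates \<open>d + 1..2 * d + 1\<close> those of the second. Conversely, \<open>form_pt d A B\<close>
  is the point \<open>[A : B]\<close>, for forms \<open>A\<close>, \<open>B\<close> of degree \<open>d\<close>, not both zero.
\<close>

definition Fa :: "nat \<Rightarrow> (nat \<Rightarrow> complex) \<Rightarrow> complex poly poly" where
  "Fa d v = hform d v"

definition Fb :: "nat \<Rightarrow> (nat \<Rightarrow> complex) \<Rightarrow> complex poly poly" where
  "Fb d v = hform d (\<lambda>i. v (d + 1 + i))"

definition form_pt :: "nat \<Rightarrow> complex poly poly \<Rightarrow> complex poly poly \<Rightarrow> (nat \<Rightarrow> complex) set" where
  "form_pt d A B = proj_pt (2 * d + 1)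
     (\<lambda>i. if i \<le> d then coeff (coeff A (d - i)) i
          else if i \<le> 2 * d + 1 then coeff (coeff B (2 * d + 1 - i)) (i - (d + 1))
          else 0)"

lemma eval2_hform: "eval2 (hform d a) x y = (\<Sum>i\<le>d. a i * x ^ i * y ^ (d - i))"
  by (simp add: eval2_def hform_def varX_def varY_def poly_sum poly_power mult_ac
      flip: pCons_one)

lemma coeff_hform:
  "coeff (coeff (hform d a) j) i = (if i + j = d then a i else 0)"
proof -
  have X: "varX ^ k = [:monom 1 k:]" for k
    by (induction k) (simp_all add: varX_def monom_Suc one_pCons monom_0 flip: pCons_one)
  have Y: "varY ^ k = monom 1 k" for k
    by (simp add: varY_def monom_altdef)
  have "coeff (coeff (hform d a) j) i
      = (\<Sum>k\<le>d. if k = i then (if d - k = j then a i else 0) else 0)"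
    unfolding hform_def X Y coeff_sum
    by (intro sum.cong) (auto simp: coeff_monom)
  also have "\<dots> = (if i + j = d then a i else 0)"
    by (auto simp: sum.delta)
  finally show ?thesis .
qed

lemma form_pt_Fa_Fb:
  assumes "v \<in> hcoords (2 * d + 1)"
  shows "form_pt d (Fa d v) (Fb d v) = proj_pt (2 * d + 1) v"
proof -
  have "(\<lambda>i. if i \<le> d then coeff (coeff (Fa d v) (d - i)) i
          else if i \<le> 2 * d + 1 then coeff (coeff (Fb d v) (2 * d + 1 - i)) (i - (d + 1))
          else 0) = v"
    using assms by (auto simp: Fa_def Fb_def coeff_hform hcoords_def fun_eq_iff)
  then show ?thesis
    by (simp add: form_pt_def)
qed

text \<open>
  The factorisation of \<open>f = [Fa : Fb]\<close> into \<open>H_f\<close> and the reduced pair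
  \<open>[hat_a : hat_b]\<close>, in terms of homogeneous coordinates \<open>v\<close> of \<open>f\<close>.
\<close>

definition Hf :: "nat \<Rightarrow> (nat \<Rightarrow> complex) \<Rightarrow> complex poly poly" where
  "Hf d v = gcd (Fa d v) (Fb d v)"

definition hat_a :: "nat \<Rightarrow> (nat \<Rightarrow> complex) \<Rightarrow> complex poly poly" where
  "hat_a d v = Fa d v div Hf d v"

definition hat_b :: "nat \<Rightarrow> (nat \<Rightarrow> complex) \<Rightarrow> complex poly poly" where
  "hat_b d v = Fb d v div Hf d v"

definition pair :: "complex \<Rightarrow> complex \<Rightarrow> nat \<Rightarrow> complex" where
  "pair x y = (\<lambda>i. if i = 0 then x else if i = 1 then y else 0)"

text \<open>The value in \<open>proj_space 1\<close> of the reduced map at the point with homogeneous coordinates \<open>w\<close>.\<close>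

definition hat_map :: "nat \<Rightarrow> (nat \<Rightarrow> complex) \<Rightarrow> (nat \<Rightarrow> complex) \<Rightarrow> (nat \<Rightarrow> complex) set" where
  "hat_map d v w =
     proj_pt 1 (pair (eval2 (hat_a d v) (w 0) (w 1)) (eval2 (hat_b d v) (w 0) (w 1)))"

text \<open>
  The components of the reduced pair are coprime forms of the same degree, which is the degree
  of the rational map; the maximum accounts for a component that is zero.
\<close>

definition hat_degree :: "nat \<Rightarrow> (nat \<Rightarrow> complex) \<Rightarrow> nat" where
  "hat_degree d v = max (total_degree (hat_a d v)) (total_degree (hat_b d v))"

text \<open>
  A point \<open>f\<close> of projective space is the set of all its homogeneous coordinate vectors. The
  conditions on \<open>v \<in> f\<close> in the following definitions do not depend on the choice of \<open>v\<close>.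
\<close>

definition Rat :: "nat \<Rightarrow> (nat \<Rightarrow> complex) set set" where
  "Rat d = {f \<in> proj_space (2 * d + 1). \<exists>v\<in>f. hat_degree d v = d}"

definition I_locus :: "nat \<Rightarrow> (nat \<Rightarrow> complex) set set" where
  "I_locus d = {f \<in> proj_space (2 * d + 1). \<exists>v\<in>f. \<exists>h\<in>proj_space 1.
     (\<forall>w\<in>hcoords 1. hat_map d v w = h) \<and> (\<forall>w\<in>h. eval2 (Hf d v) (w 0) (w 1) = 0)}"

definition newton :: "complex poly \<Rightarrow> complex \<Rightarrow> complex" where
  "newton P z = z - poly P z / poly (pderiv P) z"

text \<open>
  An element of \<open>Rat d\<close> is determined by its values at all but finitely many points, so
  the zeros of \<open>P'\<close> and the point at infinity may be left out.
\<close>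

definition NM :: "nat \<Rightarrow> (nat \<Rightarrow> complex) set set" where
  "NM d = {f \<in> Rat d. \<exists>P :: complex poly.
     lead_coeff P = 1 \<and> degree P = d \<and> card {z. poly P z = 0} = d \<and>
     (\<exists>v\<in>f. \<forall>z. poly (pderiv P) z \<noteq> 0 \<longrightarrow>
        hat_map d v (pair z 1) = proj_pt 1 (pair (newton P z) 1))}"

end

theory Submission
  imports Defs
begin

text \<open>
  For \<open>p = \<Sum>i\<le>d. p\<^sub>i X^i Y^(d-i)\<close> the Newton map is \<open>[X p\<^sub>X - p : Y p\<^sub>X]\<close>, so its coefficients
  \<open>a\<^sub>i = (i - 1) p\<^sub>i\<close> and \<open>b\<^sub>i = (i + 1) p\<^sub>i\<^sub>+\<^sub>1\<close> satisfy the linear equations \<open>b\<^sub>d = 0\<close> and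
  \<open>(i + 1) a\<^sub>i\<^sub>+\<^sub>1 = i b\<^sub>i\<close>. These define a closed set, which therefore contains the closure.
  If the forms are \<open>h\<^sub>0 H\<close> and \<open>h\<^sub>1 H\<close> with \<open>h\<^sub>1 \<noteq> 0\<close>, the equations force both forms to be
  multiples of \<open>Y^d\<close>, so that \<open>H\<close> does not vanish at \<open>h\<close>; if \<open>h\<^sub>1 = 0\<close>, they leave only \<open>[Y^d : 0]\<close>.
  Conversely the Newton maps of \<open>z^d - 1/t\<close> tend to \<open>[Y^d : 0]\<close> as \<open>t\<close> tends to \<open>0\<close>.
\<close>

section \<open>Homogeneous coordinates and the projective line\<close>

lemma proj_pt_eq_iff:
  assumes "u \<in> hcoords n"
  shows "proj_pt n u = proj_pt n v \<longleftrightarrow> (\<exists>c. c \<noteq> 0 \<and> v = (\<lambda>i. c * u i))"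
proof
  assume eq: "proj_pt n u = proj_pt n v"
  have "u \<in> proj_pt n u"
    using assms equiv_class_self[OF equiv_proj_rel] by (simp add: proj_pt_def)
  with eq have "(v, u) \<in> proj_rel n"
    by (simp add: proj_pt_def)
  then have "(u, v) \<in> proj_rel n"
    using equiv_proj_rel by (meson equivE symE)
  then show "\<exists>c. c \<noteq> 0 \<and> v = (\<lambda>i. c * u i)"
    by (simp add: proj_rel_def)
next
  assume "\<exists>c. c \<noteq> 0 \<and> v = (\<lambda>i. c * u i)"
  then obtain c where c: "c \<noteq> 0" "v = (\<lambda>i. c * u i)"
    by blast
  then have "v \<in> hcoords n"
    using assms by (simp add: hcoords_def)
  then have "(u, v) \<in> proj_rel n"
    using c assms by (auto simp: proj_rel_def)
  then show "proj_pt n u = proj_pt n v"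
    using equiv_class_eq[OF equiv_proj_rel] by (simp add: proj_pt_def)
qed

lemma in_proj_pt_iff:
  "v \<in> proj_pt n u \<longleftrightarrow> u \<in> hcoords n \<and> (\<exists>c. c \<noteq> 0 \<and> v = (\<lambda>i. c * u i))"
  by (auto simp: proj_pt_def proj_rel_def hcoords_def)

lemma proj_pt_in_proj_space: "v \<in> hcoords n \<Longrightarrow> proj_pt n v \<in> proj_space n"
  by (simp add: proj_space_def proj_pt_def quotientI)

lemma proj_pt_eq_of_mem:
  assumes "f \<in> proj_space n" "v \<in> f"
  shows "v \<in> hcoords n" "f = proj_pt n v"
proof -
  obtain u where u: "u \<in> hcoords n" "f = proj_pt n u"
    using assms(1) by (auto simp: proj_space_def proj_pt_def quotient_def)
  then obtain c where c: "c \<noteq> 0" "v = (\<lambda>i. c * u i)"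
    using assms(2) by (auto simp: in_proj_pt_iff)
  then show "v \<in> hcoords n"
    using u by (simp add: hcoords_def)
  show "f = proj_pt n v"
    using u c proj_pt_eq_iff by blast
qed

lemma hcoords_1_iff: "w \<in> hcoords 1 \<longleftrightarrow> (\<exists>x y. w = pair x y \<and> (x \<noteq> 0 \<or> y \<noteq> 0))"
proof
  assume w: "w \<in> hcoords 1"
  then have "w = pair (w 0) (w 1)"
    by (auto simp: hcoords_def pair_def fun_eq_iff)
  moreover obtain i where "w i \<noteq> 0" "i \<le> 1"
    using w unfolding hcoords_def by (auto simp: not_less[symmetric])
  then have "w 0 \<noteq> 0 \<or> w 1 \<noteq> 0"
    by (cases i) auto
  ultimately show "\<exists>x y. w = pair x y \<and> (x \<noteq> 0 \<or> y \<noteq> 0)"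
    by blast
next
  assume "\<exists>x y. w = pair x y \<and> (x \<noteq> 0 \<or> y \<noteq> 0)"
  then obtain x y where w: "w = pair x y" "x \<noteq> 0 \<or> y \<noteq> 0"
    by blast
  then have "w 0 \<noteq> 0 \<or> w 1 \<noteq> 0" "\<forall>i>1. w i = 0"
    by (simp_all add: pair_def)
  then show "w \<in> hcoords 1"
    unfolding hcoords_def by blast
qed

lemma pair_simps [simp]: "pair x y 0 = x" "pair x y (Suc 0) = y"
  by (simp_all add: pair_def)

text \<open>Lets values of the reduced map be compared without first showing that its two components
  have no common zero.\<close>

lemma proj_pt_pair_eq_cross:
  assumes "proj_pt 1 (pair x y) = proj_pt 1 (pair x' y')" "x' \<noteq> 0 \<or> y' \<noteq> 0"
  shows "y' * x = x' * y"
proof -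
  have "pair x' y' \<in> hcoords 1"
    using assms(2) hcoords_1_iff by blast
  then obtain c where "pair x y = (\<lambda>i. c * pair x' y' i)"
    using assms(1) proj_pt_eq_iff by metis
  then have "x = c * x'" "y = c * y'"
    by (metis pair_simps)+
  then show ?thesis
    by simp
qed

lemma proj_pt_pair_scale:
  assumes "c \<noteq> 0" "x \<noteq> 0 \<or> y \<noteq> 0"
  shows "proj_pt 1 (pair (c * x) (c * y)) = proj_pt 1 (pair x y)"
proof -
  have "pair x y \<in> hcoords 1"
    using assms(2) hcoords_1_iff by blast
  moreover have "pair (c * x) (c * y) = (\<lambda>i. c * pair x y i)"
    by (auto simp: pair_def)
  ultimately show ?thesis
    using assms(1) proj_pt_eq_iff by metis
qed

section \<open>Evaluation and dehomogenisation of the two forms\<close>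

lemma eval2_simps [simp]:
  "eval2 (F * G) x y = eval2 F x y * eval2 G x y" "eval2 1 x y = 1" "eval2 0 x y = 0"
  "eval2 varX x y = x" "eval2 varY x y = y" "eval2 (F ^ n) x y = eval2 F x y ^ n"
  by (simp_all add: eval2_def varX_def varY_def poly_power)

lemma eval2_Fa: "eval2 (Fa d v) x y = (\<Sum>i\<le>d. v i * x ^ i * y ^ (d - i))"
  by (simp add: Fa_def eval2_hform)

lemma eval2_Fb: "eval2 (Fb d v) x y = (\<Sum>i\<le>d. v (d + 1 + i) * x ^ i * y ^ (d - i))"
  by (simp add: Fb_def eval2_hform)

lemma hat_a_mult_Hf: "hat_a d v * Hf d v = Fa d v"
  by (simp add: hat_a_def Hf_def)

lemma hat_b_mult_Hf: "hat_b d v * Hf d v = Fb d v"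
  by (simp add: hat_b_def Hf_def)

text \<open>Cross-multiplying and then multiplying by \<open>Hf\<close> turns information on the
  reduced pair into a relation between the original forms, so the gcd need not be computed.\<close>

lemma hat_map_eq_imp_cross:
  assumes "hat_map d v w = proj_pt 1 (pair x y)" "x \<noteq> 0 \<or> y \<noteq> 0"
  shows "y * eval2 (Fa d v) (w 0) (w 1) = x * eval2 (Fb d v) (w 0) (w 1)"
proof -
  have "y * eval2 (hat_a d v) (w 0) (w 1) = x * eval2 (hat_b d v) (w 0) (w 1)"
    using assms proj_pt_pair_eq_cross by (simp add: hat_map_def)
  then show ?thesis
    by (simp flip: hat_a_mult_Hf hat_b_mult_Hf)
qed

text \<open>The form at \<open>Y = 1\<close>. Coefficients keep their index and the bound
  \<open>d\<close> is fixed, so nothing is lost, and degree and divisibility arguments can be made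
  in one variable.\<close>

definition dehom :: "nat \<Rightarrow> (nat \<Rightarrow> complex) \<Rightarrow> complex poly" where
  "dehom d a = (\<Sum>i\<le>d. monom (a i) i)"

lemma coeff_dehom: "coeff (dehom d a) i = (if i \<le> d then a i else 0)"
  by (simp add: dehom_def coeff_sum)

lemma degree_dehom_le: "degree (dehom d a) \<le> d"
  by (rule degree_le) (simp add: coeff_dehom)

lemma poly_dehom_Fa: "poly (dehom d v) z = eval2 (Fa d v) z 1"
  by (simp add: eval2_Fa dehom_def poly_sum poly_monom)

lemma poly_dehom_Fb: "poly (dehom d (\<lambda>i. v (d + 1 + i))) z = eval2 (Fb d v) z 1"
  by (simp add: eval2_Fb dehom_def poly_sum poly_monom)

section \<open>Linear equations satisfied by Newton maps and their limits\<close>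

text \<open>A nonconstant common divisor has a root \<open>a\<close>, which is then a multiple root
  of \<open>P\<close>. Removing one factor \<open>X - a\<close> keeps the set of roots but lowers
  the degree, leaving room for fewer than \<open>degree P\<close> roots.\<close>

lemma coprime_pderiv_of_card_roots:
  fixes P :: "complex poly"
  assumes "P \<noteq> 0" "card {z. poly P z = 0} = degree P"
  shows "coprime P (pderiv P)"
proof (rule coprimeI)
  fix D assume D: "D dvd P" "D dvd pderiv P"
  show "is_unit D"
  proof (rule ccontr)
    assume "\<not> is_unit D"
    moreover have "D \<noteq> 0"
      using D assms by auto
    ultimately have "degree D \<noteq> 0"
      by (simp add: is_unit_iff_degree)
    then obtain a where "poly D a = 0"
      using fundamental_theorem_of_algebra[of D] by (auto simp: constant_degree)
    then have a: "poly P a = 0" "poly (pderiv P) a = 0"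
      using D by (auto elim!: dvdE)
    then obtain Q where Q: "P = [:-a, 1:] * Q"
      by (auto simp only: poly_eq_0_iff_dvd elim!: dvdE)
    have "poly (pderiv P) a = poly Q a"
      unfolding Q pderiv_mult by (simp add: pderiv_pCons)
    with a have "poly Q a = 0"
      by simp
    with Q have roots: "{z. poly P z = 0} = {z. poly Q z = 0}"
      by auto
    have "Q \<noteq> 0"
      using Q assms by auto
    then have "degree P = Suc (degree Q)"
      unfolding Q by (subst degree_mult_eq) auto
    moreover have "card {z. poly Q z = 0} \<le> degree Q"
      using \<open>Q \<noteq> 0\<close> by (rule card_poly_roots_bound)
    ultimately show False
      using assms(2) roots by simp
  qed
qed

text \<open>Eliminates the coefficients of \<open>P\<close>: for \<open>[X P' - P : P']\<close> both
  sides equal \<open>i * (i + 1) * coeff P (i + 1)\<close>. Coordinate \<open>2 * d + 1\<close> is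
  the coefficient of \<open>X^d\<close> in the second form.\<close>

definition newton_eqs :: "nat \<Rightarrow> (nat \<Rightarrow> complex) \<Rightarrow> bool" where
  "newton_eqs d v \<longleftrightarrow>
     v (2 * d + 1) = 0 \<and> (\<forall>i<d. of_nat (i + 1) * v (i + 1) = of_nat i * v (d + 1 + i))"

lemma newton_eqs_scale: "newton_eqs d v \<Longrightarrow> newton_eqs d (\<lambda>i. c * v i)"
  unfolding newton_eqs_def by (metis mult.left_commute mult_zero_right)

text \<open>The pair \<open>X P' - P\<close>, \<open>P'\<close> is coprime, so a pair proportional
  to it is a polynomial multiple of it. Comparing degrees makes the multiplier \<open>C\<close>
  constant, and the coefficients can be read off.\<close>

lemma newton_eqs_of_proportional:
  fixes P :: "complex poly"
  assumes d: "d \<ge> 2" and P: "lead_coeff P = 1" "degree P = d" "card {z. poly P z = 0} = d"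
    and rel: "dehom d v * pderiv P = (monom 1 1 * pderiv P - P) * dehom d (\<lambda>i. v (d + 1 + i))"
  shows "newton_eqs d v"
proof -
  define A where "A = dehom d v"
  define B where "B = dehom d (\<lambda>i. v (d + 1 + i))"
  define N where "N = monom 1 1 * pderiv P - P"
  have coeff_N: "coeff N i = (of_nat i - 1) * coeff P i" for i
    unfolding N_def coeff_diff coeff_monom_mult
    by (cases i) (simp_all add: coeff_pderiv algebra_simps)
  have "coprime P (pderiv P)"
    using P by (intro coprime_pderiv_of_card_roots) auto
  \<comment> \<open>Modulo \<open>P'\<close> the proportionality reduces to
    \<open>P * B = 0\<close>.\<close>
  moreover have "pderiv P dvd P * B"
  proof -
    have "P * B = pderiv P * (monom 1 1 * B - A)"
      using rel by (simp add: A_def B_def algebra_simps)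
    then show ?thesis
      by simp
  qed
  ultimately have "pderiv P dvd B"
    by (metis coprime_commute coprime_dvd_mult_right_iff)
  then obtain C where C: "B = pderiv P * C" ..
  have "pderiv P \<noteq> 0"
    using P d by (simp add: pderiv_eq_0_iff)
  moreover have "pderiv P * A = pderiv P * (N * C)"
    using rel C unfolding A_def[symmetric] B_def[symmetric] N_def[symmetric] by (simp add: mult_ac)
  ultimately have A: "A = N * C"
    by simp
  \<comment> \<open>This coefficient is \<open>d - 1\<close>, nonzero since \<open>d\<close> is at
    least 2. So \<open>N\<close> already uses up the whole degree allowed for
    \<open>A\<close>.\<close>
  have "coeff N d \<noteq> 0"
    using P d by (auto simp: coeff_N)
  then have "d \<le> degree N" "N \<noteq> 0"
    by (auto intro: le_degree)
  moreover have "degree A \<le> d"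
    by (simp add: A_def degree_dehom_le)
  ultimately have "degree C = 0"
    unfolding A by (cases "C = 0") (auto simp: degree_mult_eq)
  then obtain c where c: "C = [:c:]"
    by (rule degree_eq_zeroE)
  have a: "coeff A i = c * ((of_nat i - 1) * coeff P i)" for i
    by (simp add: A c coeff_N)
  have b: "coeff B i = c * (of_nat (Suc i) * coeff P (Suc i))" for i
    by (simp add: C c coeff_pderiv)
  have "v (2 * d + 1) = 0"
    using b[of d] P(2) by (simp add: B_def coeff_dehom coeff_eq_0 mult_2)
  moreover have "of_nat (i + 1) * v (i + 1) = of_nat i * v (d + 1 + i)" if "i < d" for i
    using a[of "i + 1"] b[of i] that by (simp add: A_def B_def coeff_dehom)
  ultimately show ?thesis
    by (simp add: newton_eqs_def)
qed

lemma newton_eqs_of_NM: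
  assumes d: "d \<ge> 2" and f: "f \<in> NM d"
  obtains v where "v \<in> f" "newton_eqs d v"
proof -
  obtain P v where P: "lead_coeff P = 1" "degree P = d" "card {z. poly P z = 0} = d"
    and v: "v \<in> f"
    and nv: "\<And>z. poly (pderiv P) z \<noteq> 0 \<Longrightarrow>
      hat_map d v (pair z 1) = proj_pt 1 (pair (newton P z) 1)"
    using f by (auto simp: NM_def)
  let ?A = "dehom d v" and ?B = "dehom d (\<lambda>i. v (d + 1 + i))"
  have P': "pderiv P \<noteq> 0"
    using P d by (simp add: pderiv_eq_0_iff)
  have "?A * pderiv P = (monom 1 1 * pderiv P - P) * ?B"
  proof -
    \<comment> \<open>The definition of \<open>NM\<close> says nothing at zeros of
      \<open>P'\<close>. The extra factor \<open>P'\<close> makes both sides vanish there and is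
      cancelled afterwards as a polynomial.\<close>
    have "poly (pderiv P * (?A * pderiv P)) z
        = poly (pderiv P * ((monom 1 1 * pderiv P - P) * ?B)) z" for z
    proof (cases "poly (pderiv P) z = 0")
      case False
      then have "poly ?A z = newton P z * poly ?B z"
        using hat_map_eq_imp_cross[OF nv[OF False]] by (simp add: poly_dehom_Fa[of d v] poly_dehom_Fb[of d v, simplified])
      moreover have "poly (pderiv P) z * newton P z = z * poly (pderiv P) z - poly P z"
        using False by (simp add: newton_def field_simps)
      ultimately have "poly (pderiv P) z * poly ?A z = (z * poly (pderiv P) z - poly P z) * poly ?B z"
        by (simp only: mult.assoc[symmetric])
      then show ?thesis
        by (simp only: poly_mult poly_diff poly_monom power_one_right mult_1 mult.commute[of "poly ?A z"])
    qed simp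
    then have "pderiv P * (?A * pderiv P) = pderiv P * ((monom 1 1 * pderiv P - P) * ?B)"
      by (simp add: poly_eq_poly_eq_iff[symmetric] fun_eq_iff)
    then show ?thesis
      using P' by (simp only: mult_cancel_left) simp
  qed
  then have "newton_eqs d v"
    using newton_eqs_of_proportional[OF d P] by blast
  with v show thesis
    by (rule that)
qed

text \<open>The equations are homogeneous, so they hold for one representative exactly when they
  hold for all. The preimage under the quotient map is thus cut out by continuous equations.\<close>

lemma closedin_newton_eqs:
  "closedin (proj_topology (2 * d + 1)) {f \<in> proj_space (2 * d + 1). \<exists>v\<in>f. newton_eqs d v}"
    (is "closedin _ ?K")
proof -
  let ?n = "2 * d + 1"
  have pre: "{v \<in> hcoords ?n. proj_pt ?n v \<in> ?K} = {v \<in> hcoords ?n. newton_eqs d v}"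
  proof (intro Collect_cong conj_cong refl)
    fix v assume v: "v \<in> hcoords ?n"
    show "proj_pt ?n v \<in> ?K \<longleftrightarrow> newton_eqs d v"
    proof
      assume "proj_pt ?n v \<in> ?K"
      then obtain u where u: "u \<in> proj_pt ?n v" "newton_eqs d u"
        by blast
      then obtain c where c: "c \<noteq> 0" "u = (\<lambda>i. c * v i)"
        by (auto simp: in_proj_pt_iff)
      then show "newton_eqs d v"
        using newton_eqs_scale[OF u(2), of "inverse c"] by (simp add: mult.assoc[symmetric])
    next
      assume "newton_eqs d v"
      moreover have "v \<in> proj_pt ?n v"
        using v by (auto simp: in_proj_pt_iff intro: exI[of _ 1])
      ultimately show "proj_pt ?n v \<in> ?K"
        using v proj_pt_in_proj_space by blast
    qed
  qed
  have "closed {v. newton_eqs d v}"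
    unfolding newton_eqs_def
    by (intro closed_Collect_conj closed_Collect_all closed_Collect_imp open_Collect_const
        closed_Collect_eq continuous_intros continuous_on_product_coordinates)
  then have "closedin (top_of_set (hcoords ?n)) {v \<in> hcoords ?n. newton_eqs d v}"
    by (metis Collect_conj_eq Collect_mem_eq closedin_closed_Int)
  then have "closedin (top_of_set (hcoords ?n)) {v \<in> hcoords ?n. proj_pt ?n v \<in> ?K}"
    by (simp only: pre)
  moreover have "?K \<subseteq> proj_space ?n"
    by blast
  ultimately show ?thesis
    using quotient_map_proj_pt[of ?n]
    unfolding quotient_map_closedin topspace_proj_topology topspace_euclidean_subtopology
    by blast
qed

section \<open>A family of Newton maps degenerating to \<open>[Y^d : 0]\<close>\<close>

text \<open>The coordinates of \<open>[Y^d + (d - 1) t X^d : d t X^(d-1) Y]\<close>, the Newton map of \<open>z^d - 1/t\<close>.\<close>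

definition newton_curve :: "nat \<Rightarrow> complex \<Rightarrow> nat \<Rightarrow> complex" where
  "newton_curve d t i =
     (if i = 0 then 1 else if i = d then of_nat (d - 1) * t
      else if i = 2 * d then of_nat d * t else 0)"

lemma newton_curve_in_hcoords: "newton_curve d t \<in> hcoords (2 * d + 1)"
  by (auto simp: hcoords_def newton_curve_def intro!: exI[of _ 0])

lemma form_pt_eq_newton_curve:
  assumes d: "d \<ge> 1"
  shows "form_pt d (varY ^ d) 0 = proj_pt (2 * d + 1) (newton_curve d 0)"
proof -
  have "varY ^ d = monom 1 d"
    by (simp add: varY_def monom_altdef)
  then show ?thesis
    unfolding form_pt_def using d
    by (intro arg_cong[of _ _ "proj_pt _"]) (auto simp: fun_eq_iff newton_curve_def)
qed

lemma hform_newton_curve: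
  assumes "d \<ge> 2"
  shows "Fa d (newton_curve d t) = varY ^ d + smult [:of_nat (d - 1) * t:] (varX ^ d)"
    and "Fb d (newton_curve d t) = smult [:of_nat d * t:] (varX ^ (d - 1) * varY)"
proof -
  have "Fa d (newton_curve d t) = (\<Sum>i\<in>{0, d}. smult [:newton_curve d t i:] (varX ^ i * varY ^ (d - i)))"
    unfolding Fa_def hform_def
    by (rule sum.mono_neutral_right) (use assms in \<open>auto simp: newton_curve_def\<close>)
  then show "Fa d (newton_curve d t) = varY ^ d + smult [:of_nat (d - 1) * t:] (varX ^ d)"
    using assms by (simp add: newton_curve_def one_pCons[symmetric])
  \<comment> \<open>Coordinate \<open>2 * d = d + 1 + (d - 1)\<close> belongs to
    \<open>X^(d-1) Y\<close> in the second form; coordinates \<open>0\<close> and \<open>d\<close>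
    lie in the first.\<close>
  have "Fb d (newton_curve d t)
      = (\<Sum>i\<in>{d - 1}. smult [:newton_curve d t (d + 1 + i):] (varX ^ i * varY ^ (d - i)))"
    unfolding Fb_def hform_def
    by (rule sum.mono_neutral_right) (use assms in \<open>auto simp: newton_curve_def\<close>)
  then show "Fb d (newton_curve d t) = smult [:of_nat d * t:] (varX ^ (d - 1) * varY)"
    using assms by (simp add: newton_curve_def)
qed

text \<open>A divisor of \<open>varX\<close> has degree 0 in the outer variable, hence is some
  \<open>[:q:]\<close>. Since it also divides \<open>varY\<close>, whose coefficient at 1 is 1,
  \<open>q\<close> is a unit.\<close>

lemma coprime_varX_varY: "coprime varX varY"
proof (rule coprimeI)
  fix D assume "D dvd varX" "D dvd varY"
  then obtain E G where E: "varX = D * E" and G: "varY = D * G"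
    by (auto elim!: dvdE)
  have "varX \<noteq> 0"
    by (simp add: varX_def)
  with E have "D \<noteq> 0" "E \<noteq> 0"
    by auto
  then have "degree D = 0"
    using arg_cong[OF E, of degree] by (simp add: degree_mult_eq varX_def)
  then obtain q where q: "D = [:q:]"
    by (rule degree_eq_zeroE)
  have "q * coeff G 1 = 1"
    using arg_cong[OF G, of "\<lambda>F. coeff F 1"] by (simp add: q varY_def)
  then have "q dvd 1"
    by (metis dvd_triv_left)
  then show "is_unit D"
    by (simp add: q is_unit_const_poly_iff)
qed

text \<open>The second form is a unit times \<open>X^(d-1) Y\<close>, so \<open>X\<close> and
  \<open>Y\<close> can be treated separately. A common divisor of the first form with either
  variable divides a power of the other one; for \<open>Y\<close> this uses that
  \<open>(d - 1) t\<close> is nonzero.\<close>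

lemma coprime_newton_curve:
  assumes d: "d \<ge> 2" and t: "t \<noteq> 0"
  shows "coprime (Fa d (newton_curve d t)) (Fb d (newton_curve d t))"
proof -
  define S where "S = varY ^ d + smult [:of_nat (d - 1) * t:] (varX ^ d)"
  have unit: "smult [:c:] F dvd F" if "c \<noteq> 0" for c :: complex and F
  proof -
    have "F = smult [:c:] F * [:[:inverse c:]:]"
      using that by (simp add: one_pCons[symmetric])
    then show ?thesis
      by (metis dvd_triv_left)
  qed
  have "coprime S varX"
  proof (rule coprimeI)
    fix D assume D: "D dvd S" "D dvd varX"
    then have "D dvd smult [:of_nat (d - 1) * t:] (varX ^ d)"
      using d by (intro dvd_smult dvd_power_same[THEN dvd_trans] dvd_trans[OF D(2)] dvd_power) auto
    with D have "D dvd varY ^ d"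
      by (simp add: S_def dvd_add_left_iff)
    then show "is_unit D"
      using D(2) coprime_varX_varY by (meson coprime_common_divisor coprime_power_right_iff)
  qed
  moreover have "coprime S varY"
  proof (rule coprimeI)
    fix D assume D: "D dvd S" "D dvd varY"
    then have "D dvd varY ^ d"
      using d by (intro dvd_trans[OF D(2)] dvd_power) auto
    with D have "D dvd smult [:of_nat (d - 1) * t:] (varX ^ d)"
      by (simp add: S_def dvd_add_right_iff)
    then have "D dvd varX ^ d"
      using unit[of "of_nat (d - 1) * t" "varX ^ d"] d t by (auto intro: dvd_trans)
    then show "is_unit D"
      using D(2) coprime_varX_varY by (meson coprime_common_divisor coprime_power_left_iff)
  qed
  ultimately have "coprime S (varX ^ (d - 1) * varY)"
    by simp
  moreover have "smult [:of_nat d * t:] (varX ^ (d - 1) * varY) dvd varX ^ (d - 1) * varY"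
    using d t by (intro unit) auto
  ultimately show ?thesis
    unfolding hform_newton_curve[OF d] S_def[symmetric]
    by (meson coprime_divisors dvd_refl)
qed

lemma total_degree_hform:
  assumes "i \<le> d" "a i \<noteq> 0"
  shows "total_degree (hform d a) = d"
proof -
  have "{i + j |i j. coeff (coeff (hform d a) j) i \<noteq> 0} = {d}"
  proof (intro equalityI subsetI)
    fix k assume "k \<in> {d}"
    then have "k = i + (d - i)" "coeff (coeff (hform d a) (d - i)) i \<noteq> 0"
      using assms by (auto simp: coeff_hform)
    then show "k \<in> {i + j |i j. coeff (coeff (hform d a) j) i \<noteq> 0}"
      by blast
  qed (auto simp: coeff_hform split: if_splits)
  then show ?thesis
    by (simp add: total_degree_def)
qed

lemma newton_curve_in_NM:
  assumes d: "d \<ge> 2" and t: "t \<noteq> 0"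
  shows "proj_pt (2 * d + 1) (newton_curve d t) \<in> NM d"
proof -
  let ?v = "newton_curve d t"
  have mem: "?v \<in> proj_pt (2 * d + 1) ?v"
    using newton_curve_in_hcoords by (auto simp: in_proj_pt_iff intro: exI[of _ 1])
  have "Hf d ?v = 1"
    using coprime_newton_curve[OF d t] by (simp add: Hf_def)
  then have hat: "hat_a d ?v = Fa d ?v" "hat_b d ?v = Fb d ?v"
    by (simp_all add: hat_a_def hat_b_def)
  have "total_degree (Fa d ?v) = d"
    unfolding Fa_def by (rule total_degree_hform[of 0]) (simp_all add: newton_curve_def)
  moreover have "total_degree (Fb d ?v) = d"
    unfolding Fb_def
    by (rule total_degree_hform[of "d - 1"]) (use d t in \<open>auto simp: newton_curve_def\<close>)
  ultimately have "hat_degree d ?v = d"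
    by (simp add: hat_degree_def hat)
  then have Rat: "proj_pt (2 * d + 1) ?v \<in> Rat d"
    using mem proj_pt_in_proj_space[OF newton_curve_in_hcoords] by (auto simp: Rat_def)
  define P :: "complex poly" where "P = monom 1 d - [:1 / t:]"
  have poly_P: "poly P z = z ^ d - 1 / t" for z
    by (simp add: P_def poly_monom)
  have coeff_P: "coeff P i = (if i = d then 1 else if i = 0 then - (1 / t) else 0)" for i
    using d by (cases i) (auto simp: P_def)
  have degP: "degree P = d"
    by (intro antisym degree_le le_degree) (auto simp: coeff_P)
  then have "lead_coeff P = 1"
    by (simp add: coeff_P)
  have "{z. poly P z = 0} = {z. z ^ d = 1 / t}"
    by (simp add: poly_P)
  then have cardP: "card {z. poly P z = 0} = d"
    using card_nth_roots[of "1 / t" d] d t by simp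
  have dP: "poly (pderiv P) z = of_nat d * z ^ (d - 1)" for z
    by (simp add: P_def pderiv_diff pderiv_monom poly_monom pderiv_pCons)
  have "hat_map d ?v (pair z 1) = proj_pt 1 (pair (newton P z) 1)"
    if z: "poly (pderiv P) z \<noteq> 0" for z
  proof -
    \<comment> \<open>\<open>e\<close> is the value of the second form at \<open>(z, 1)\<close>; the
      two forms there are \<open>e\<close> times \<open>newton P z\<close> and
      \<open>1\<close>.\<close>
    define e where "e = of_nat d * t * z ^ (d - 1)"
    have e: "e \<noteq> 0"
      using z t by (auto simp: e_def dP)
    have zd: "z ^ d = z * z ^ (d - 1)"
      using d by (cases d) auto
    have "newton P z = z - (z ^ d - 1 / t) / (of_nat d * z ^ (d - 1))"
      by (simp add: newton_def poly_P dP)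
    also have "\<dots> = z - (t * z ^ d - 1) / e"
      using t z by (simp add: e_def dP field_simps)
    finally have "e * newton P z = e * z - (t * z ^ d - 1)"
      using e by (simp add: field_simps)
    also have "\<dots> = 1 + of_nat (d - 1) * t * z ^ d"
      using d by (simp add: e_def zd of_nat_diff algebra_simps)
    also have "\<dots> = eval2 (Fa d ?v) z 1"
      using d unfolding hform_newton_curve[OF d] by (simp add: eval2_def varX_def varY_def poly_power)
    finally have "eval2 (Fa d ?v) z 1 = e * newton P z" ..
    moreover have "eval2 (Fb d ?v) z 1 = e * 1"
      using d unfolding hform_newton_curve[OF d] by (simp add: e_def eval2_def varX_def varY_def poly_power)
    ultimately show ?thesis
      using proj_pt_pair_scale[OF e, of "newton P z" 1] by (simp add: hat_map_def hat)
  qed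
  then show ?thesis
    using Rat degP \<open>lead_coeff P = 1\<close> cardP mem unfolding NM_def by blast
qed

text \<open>The curve is continuous also at \<open>t = 0\<close>, where it meets
  \<open>[Y^d : 0]\<close>, and 0 is a limit of the nonzero parameters, which give points of
  \<open>NM d\<close>.\<close>

lemma form_pt_in_closure_NM:
  assumes "d \<ge> 2"
  shows "form_pt d (varY ^ d) 0 \<in> proj_topology (2 * d + 1) closure_of NM d"
proof -
  let ?g = "\<lambda>t. proj_pt (2 * d + 1) (newton_curve d t)"
  have "continuous_on UNIV (newton_curve d)"
  proof (rule continuous_on_coordinatewise_then_product)
    show "continuous_on UNIV (\<lambda>t. newton_curve d t i)" for i
      unfolding newton_curve_def
      by (cases "i = 0"; cases "i = d"; cases "i = 2 * d") (auto intro!: continuous_intros)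
  qed
  then have "continuous_map euclidean (top_of_set (hcoords (2 * d + 1))) (newton_curve d)"
    using newton_curve_in_hcoords by (auto simp: continuous_map_in_subtopology)
  then have "continuous_map euclidean (proj_topology (2 * d + 1)) (proj_pt (2 * d + 1) \<circ> newton_curve d)"
    using quotient_imp_continuous_map[OF quotient_map_proj_pt] by (rule continuous_map_compose)
  then have "?g ` (euclidean closure_of (- {0})) \<subseteq> proj_topology (2 * d + 1) closure_of (?g ` (- {0}))"
    unfolding o_def by (rule continuous_map_image_closure_subset)
  moreover have "0 \<in> euclidean closure_of (- {0 :: complex})"
    by (simp add: closure_complement)
  ultimately have "?g 0 \<in> proj_topology (2 * d + 1) closure_of (?g ` (- {0}))"
    by (meson image_subset_iff)
  moreover have "?g ` (- {0}) \<subseteq> NM d"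
    using newton_curve_in_NM[OF assms] by auto
  ultimately show ?thesis
    using closure_of_mono[of "?g ` (- {0})" "NM d"] form_pt_eq_newton_curve[of d] assms by auto
qed

section \<open>The locus \<open>I(d)\<close> and the linear equations\<close>

text \<open>Up to a unit the gcd is \<open>Y^d\<close>, the reduced map is the constant
  \<open>[1 : 0]\<close>, and \<open>Y^d\<close> vanishes there.\<close>

lemma form_pt_in_I_locus:
  assumes d: "d \<ge> 2"
  shows "form_pt d (varY ^ d) 0 \<in> I_locus d"
proof -
  let ?v = "newton_curve d 0"
  have mem: "?v \<in> proj_pt (2 * d + 1) ?v"
    using newton_curve_in_hcoords by (auto simp: in_proj_pt_iff intro: exI[of _ 1])
  have F: "Fa d ?v = varY ^ d" "Fb d ?v = 0"
    using hform_newton_curve[OF d, of 0] by simp_all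
  \<comment> \<open>Divisibility is enough: the cofactor \<open>K\<close> turns out to be inverse to
    \<open>hat_a\<close>, so \<open>hat_a\<close> has no zeros, whatever the normalisation of the
    gcd.\<close>
  have "varY ^ d dvd Hf d ?v"
    by (simp add: Hf_def F)
  then obtain K where K: "Hf d ?v = varY ^ d * K" ..
  have "varY ^ d * (K * hat_a d ?v) = varY ^ d * 1"
    using hat_a_mult_Hf[of d ?v] by (simp add: K F mult_ac)
  then have "K * hat_a d ?v = 1"
    by (subst (asm) mult_cancel_left) (simp add: varY_def)
  then have "eval2 K x y * eval2 (hat_a d ?v) x y = 1" for x y
    by (metis eval2_simps(1,2))
  then have "eval2 (hat_a d ?v) x y \<noteq> 0" for x y
    by (metis mult_zero_right zero_neq_one)
  then have "hat_map d ?v w = proj_pt 1 (pair 1 0)" for w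
    using proj_pt_pair_scale[of "eval2 (hat_a d ?v) (w 0) (w 1)" 1 0]
    by (simp add: hat_map_def hat_b_def F)
  moreover have "pair 1 0 \<in> hcoords 1"
    using hcoords_1_iff by force
  then have "proj_pt 1 (pair 1 0) \<in> proj_space 1"
    by (rule proj_pt_in_proj_space)
  moreover have "eval2 (Hf d ?v) (w 0) (w 1) = 0" if "w \<in> proj_pt 1 (pair 1 0)" for w
    using that d by (auto simp: in_proj_pt_iff K)
  ultimately have "\<exists>h\<in>proj_space 1. (\<forall>w\<in>hcoords 1. hat_map d ?v w = h)
      \<and> (\<forall>w\<in>h. eval2 (Hf d ?v) (w 0) (w 1) = 0)"
    by blast
  then have "proj_pt (2 * d + 1) ?v \<in> I_locus d"
    using mem proj_pt_in_proj_space[OF newton_curve_in_hcoords] unfolding I_locus_def by blast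
  then show ?thesis
    using d form_pt_eq_newton_curve by simp
qed

text \<open>Descending induction from \<open>b_d = 0\<close>: if \<open>b_(n+1) = 0\<close>, then
  \<open>a_(n+1) = 0\<close> by proportionality, and the equation at \<open>n\<close> gives
  \<open>n b_n = 0\<close>. It stops at 1 because the equation at 0 does not constrain
  \<open>b_0\<close>.\<close>

lemma newton_eqs_constant_hat:
  assumes eqs: "newton_eqs d v" and rel: "\<And>i. i \<le> d \<Longrightarrow> y * v i = x * v (d + 1 + i)"
    and y: "y \<noteq> 0" and i: "1 \<le> i" "i \<le> d"
  shows "v (d + 1 + i) = 0"
  using i(2,1)
proof (induction i rule: inc_induct)
  case base
  then show ?case
    using eqs by (simp add: newton_eqs_def mult_2)
next
  case (step n)
  then have "of_nat (n + 1) * (y * v (n + 1)) = y * (of_nat n * v (d + 1 + n))"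
    using eqs unfolding newton_eqs_def by (metis mult.left_commute)
  moreover have "y * v (n + 1) = 0"
    using step rel[of "n + 1"] by simp
  ultimately show ?case
    using y step by simp
qed

lemma eq_form_pt_of_newton_eqs:
  assumes d: "d \<ge> 2" and v: "v \<in> hcoords (2 * d + 1)" and eqs: "newton_eqs d v"
    and h: "h \<in> proj_space 1" and const: "\<forall>w\<in>hcoords 1. hat_map d v w = h"
    and zero: "\<forall>w\<in>h. eval2 (Hf d v) (w 0) (w 1) = 0"
  shows "proj_pt (2 * d + 1) v = form_pt d (varY ^ d) 0"
proof -
  obtain w where w: "w \<in> hcoords 1" "h = proj_pt 1 w"
    using h by (auto simp: proj_space_def quotient_def proj_pt_def)
  then obtain x y where xy: "h = proj_pt 1 (pair x y)" "x \<noteq> 0 \<or> y \<noteq> 0"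
    by (metis hcoords_1_iff)
  then have mem: "pair x y \<in> h"
    using hcoords_1_iff by (auto simp: in_proj_pt_iff intro: exI[of _ 1])
  \<comment> \<open>The affine chart \<open>Y = 1\<close> has enough points to turn equality of
    values into equality of all coefficients.\<close>
  have "poly (smult y (dehom d v)) z = poly (smult x (dehom d (\<lambda>i. v (d + 1 + i)))) z" for z
  proof -
    have "pair z 1 \<in> hcoords 1"
      using hcoords_1_iff by force
    then have "hat_map d v (pair z 1) = proj_pt 1 (pair x y)"
      using const xy by simp
    from hat_map_eq_imp_cross[OF this xy(2)] show ?thesis
      by (simp add: poly_dehom_Fa[of d v] poly_dehom_Fb[of d v, simplified])
  qed
  then have "smult y (dehom d v) = smult x (dehom d (\<lambda>i. v (d + 1 + i)))"
    by (simp add: poly_eq_poly_eq_iff[symmetric] fun_eq_iff)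
  then have rel: "y * v i = x * v (d + 1 + i)" if "i \<le> d" for i
    using that by (auto simp: poly_eq_iff coeff_dehom dest: spec[of _ i])
  have "y = 0"
  proof (rule ccontr)
    assume y: "y \<noteq> 0"
    have b: "v (d + 1 + i) = 0" if "1 \<le> i" "i \<le> d" for i
      using newton_eqs_constant_hat[OF eqs rel y] that by blast
    have a: "v i = 0" if "1 \<le> i" "i \<le> d" for i
      using rel[of i] b[of i] y that by simp
    \<comment> \<open>This is \<open>b_0\<close>, the coefficient of \<open>Y^d\<close> in the
      second form. Together with proportionality it determines every remaining coordinate.\<close>
    have "v (d + 1) \<noteq> 0"
    proof
      assume 0: "v (d + 1) = 0"
      have "v i = 0" for i
      proof -
        consider "i = 0" | "1 \<le> i" "i \<le> d" | "i = d + 1" | "d + 2 \<le> i" "i \<le> 2 * d + 1" | "2 * d + 1 < i"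
          by linarith
        then show ?thesis
        proof cases
          case 1
          then show ?thesis using rel[of 0] 0 y by simp
        next
          case 4
          then show ?thesis using b[of "i - (d + 1)"] by simp
        qed (use a 0 v in \<open>auto simp: hcoords_def\<close>)
      qed
      then show False
        using v by (simp add: hcoords_def)
    qed
    moreover have "eval2 (Fb d v) x y = v (d + 1) * y ^ d"
    proof -
      have "eval2 (Fb d v) x y = (\<Sum>i\<in>{0}. v (d + 1 + i) * x ^ i * y ^ (d - i))"
        unfolding eval2_Fb by (rule sum.mono_neutral_right) (use b in auto)
      then show ?thesis
        by simp
    qed
    \<comment> \<open>\<open>Hf\<close> divides the second form and vanishes at
      \<open>h = [x : y]\<close>; yet that form is \<open>b_0 Y^d\<close> with \<open>b_0\<close>
      and \<open>y\<close> nonzero.\<close>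
    moreover have "eval2 (Fb d v) x y = 0"
      using zero mem by (force simp flip: hat_b_mult_Hf)
    ultimately show False
      using y by simp
  qed
  \<comment> \<open>Now \<open>x\<close> is nonzero, so proportionality makes the whole second form
    zero, including \<open>b_0\<close>.\<close>
  with xy rel have b: "v (d + 1 + i) = 0" if "i \<le> d" for i
    using that by auto
  have v0: "v i = 0" if "i \<noteq> 0" for i
  proof -
    consider "1 \<le> i" "i \<le> d" | "d + 1 \<le> i" "i \<le> 2 * d + 1" | "2 * d + 1 < i"
      using \<open>i \<noteq> 0\<close> by linarith
    then show ?thesis
    proof cases
      case 1
      \<comment> \<open>With \<open>b_k = 0\<close> the equation at \<open>k = i - 1\<close> kills
        \<open>a_i\<close>. No equation involves \<open>a_0\<close>, the coefficient of
        \<open>Y^d\<close>, which survives.\<close>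
      then obtain k where k: "i = k + 1" "k < d"
        using that[of "i - 1"] by simp
      then have "of_nat (k + 1) * v (k + 1) = of_nat k * v (d + 1 + k)"
        using eqs unfolding newton_eqs_def by blast
      then have "of_nat (k + 1) * v i = 0"
        using b[of k] k by simp
      then show ?thesis
        unfolding mult_eq_0_iff of_nat_eq_0_iff by simp
    next
      case 2
      then show ?thesis using b[of "i - (d + 1)"] by simp
    qed (use v in \<open>auto simp: hcoords_def\<close>)
  qed
  moreover obtain j where "v j \<noteq> 0"
    using v by (auto simp: hcoords_def)
  ultimately have "v 0 \<noteq> 0"
    by (cases "j = 0") auto
  moreover have "v = (\<lambda>i. v 0 * newton_curve d 0 i)"
    using v0 by (auto simp: newton_curve_def fun_eq_iff)
  ultimately have "proj_pt (2 * d + 1) (newton_curve d 0) = proj_pt (2 * d + 1) v"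
    using proj_pt_eq_iff[OF newton_curve_in_hcoords] by blast
  then show ?thesis
    using form_pt_eq_newton_curve d by simp
qed

theorem proposition2p18:
  fixes d :: nat
  assumes "d \<ge> 2"
  shows "(proj_topology (2 * d + 1) closure_of NM d) \<inter> I_locus d = {form_pt d (varY ^ d) 0}"
proof
  show "{form_pt d (varY ^ d) 0} \<subseteq> (proj_topology (2 * d + 1) closure_of NM d) \<inter> I_locus d"
    using form_pt_in_closure_NM[OF assms] form_pt_in_I_locus[OF assms] by blast
  have "NM d \<subseteq> {f \<in> proj_space (2 * d + 1). \<exists>v\<in>f. newton_eqs d v}"
  proof
    fix f assume f: "f \<in> NM d"
    then obtain v where "v \<in> f" "newton_eqs d v"
      by (rule newton_eqs_of_NM[OF assms])
    moreover from f have "f \<in> proj_space (2 * d + 1)"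
      by (simp add: NM_def Rat_def)
    ultimately show "f \<in> {f \<in> proj_space (2 * d + 1). \<exists>v\<in>f. newton_eqs d v}"
      by blast
  qed
  then have closure: "proj_topology (2 * d + 1) closure_of NM d
      \<subseteq> {f \<in> proj_space (2 * d + 1). \<exists>v\<in>f. newton_eqs d v}"
    using closedin_newton_eqs by (rule closure_of_minimal)
  show "(proj_topology (2 * d + 1) closure_of NM d) \<inter> I_locus d \<subseteq> {form_pt d (varY ^ d) 0}"
  proof
    fix f assume f: "f \<in> (proj_topology (2 * d + 1) closure_of NM d) \<inter> I_locus d"
    then obtain v h where fs: "f \<in> proj_space (2 * d + 1)" "v \<in> f" and h: "h \<in> proj_space 1"
        "\<forall>w\<in>hcoords 1. hat_map d v w = h" "\<forall>w\<in>h. eval2 (Hf d v) (w 0) (w 1) = 0"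
      unfolding I_locus_def by blast
    have v: "v \<in> hcoords (2 * d + 1)" "f = proj_pt (2 * d + 1) v"
      using proj_pt_eq_of_mem[OF fs] .
    \<comment> \<open>The representative \<open>u\<close> satisfying the equations may differ from
      the \<open>v\<close> supplied by \<open>I_locus\<close>; a scalar carries the equations over
      to \<open>v\<close>.\<close>
    obtain u where u: "u \<in> f" "newton_eqs d u"
      using f closure by blast
    have "u \<in> hcoords (2 * d + 1)" "proj_pt (2 * d + 1) u = proj_pt (2 * d + 1) v"
      using proj_pt_eq_of_mem[OF fs(1) u(1)] v by auto
    then obtain c where "v = (\<lambda>i. c * u i)"
      using proj_pt_eq_iff by blast
    then have "newton_eqs d v"
      using newton_eqs_scale[OF u(2)] by simp
    then show "f \<in> {form_pt d (varY ^ d) 0}"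
      using eq_form_pt_of_newton_eqs[OF assms v(1) _ h] v(2) by simp
  qed
qed

end
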